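(* For every integer $n$ with $2\leq n\leq 9$, the set of primitive characteristic vectors of norm $9-n$ in the lattice $\mathrm{I}_{1,n}$ is non-empty and forms exactly one orbit under $\mathrm{Aut}(\mathrm{I}_{1,n})$.
   Context: $\mathrm{I}_{1,n}$ denotes the odd unimodular lattice of signature $(1,n)$: the group $\mathbb{Z}^{n+1}$, with vectors written $u=(u^0;u^1,\ldots,u^n)$, and bilinear form $u\cdot v = u^0v^0-\sum_{i=1}^n u^iv^i$. The norm of $u$ is $u^2=u\cdot u$. $\mathrm{Aut}(\mathrm{I}_{1,n})$ is the group of all $\mathbb{Z}$-linear automorphisms of the lattice preserving the bilinear form. A vector $u$ in a lattice $\Gamma$ is primitive if there is no integer $k>1$ with $u\in k\Gamma$; it is characteristic if $u\cdot x\equiv x\cdot x \pmod 2$ for all $x\in\Gamma$ (for $\mathrm{I}_{1,n}$, equivalently, all $u^\alpha$ are odd). *)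

theory Defs
  imports "HOL-Algebra.Group_Action" "HOL-Number_Theory.Cong"
begin

text \<open>
  Vectors \<open>(u\<^sup>0; u\<^sup>1, \<dots>, u\<^sup>n)\<close> of the lattice \<open>I\<^sub>1\<^sub>,\<^sub>n\<close> are functions \<open>u :: nat \<Rightarrow> int\<close> that vanish
  beyond index \<open>n\<close>, so that equality of vectors is equality of functions.
\<close>

definition lat :: "nat \<Rightarrow> (nat \<Rightarrow> int) set" where
  "lat n = {u. \<forall>i>n. u i = 0}"

definition form :: "nat \<Rightarrow> (nat \<Rightarrow> int) \<Rightarrow> (nat \<Rightarrow> int) \<Rightarrow> int" where
  "form n u v = u 0 * v 0 - (\<Sum>i=1..n. u i * v i)"

definition lat_linear :: "nat \<Rightarrow> ((nat \<Rightarrow> int) \<Rightarrow> (nat \<Rightarrow> int)) \<Rightarrow> bool" where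
  "lat_linear n f \<longleftrightarrow>
    (\<forall>a b. \<forall>u\<in>lat n. \<forall>v\<in>lat n.
      f (\<lambda>i. a * u i + b * v i) = (\<lambda>i. a * f u i + b * f v i))"

definition preserves_form :: "nat \<Rightarrow> ((nat \<Rightarrow> int) \<Rightarrow> (nat \<Rightarrow> int)) \<Rightarrow> bool" where
  "preserves_form n f \<longleftrightarrow> (\<forall>u\<in>lat n. \<forall>v\<in>lat n. form n (f u) (f v) = form n u v)"

definition Aut_lat :: "nat \<Rightarrow> ((nat \<Rightarrow> int) \<Rightarrow> (nat \<Rightarrow> int)) monoid" where
  "Aut_lat n = (BijGroup (lat n))
     \<lparr>carrier := {f \<in> Bij (lat n). lat_linear n f \<and> preserves_form n f}\<rparr>"

definition primitive :: "nat \<Rightarrow> (nat \<Rightarrow> int) \<Rightarrow> bool" where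
  "primitive n u \<longleftrightarrow> \<not> (\<exists>k>1. u \<in> (\<lambda>v i. k * v i) ` lat n)"

definition characteristic :: "nat \<Rightarrow> (nat \<Rightarrow> int) \<Rightarrow> bool" where
  "characteristic n u \<longleftrightarrow> (\<forall>x\<in>lat n. [form n u x = form n x x] (mod 2))"

definition prim_char_vectors :: "nat \<Rightarrow> int \<Rightarrow> (nat \<Rightarrow> int) set" where
  "prim_char_vectors n m = {u \<in> lat n. primitive n u \<and> characteristic n u \<and> form n u u = m}"

lemma lat_lin_comb: "u \<in> lat n \<Longrightarrow> v \<in> lat n \<Longrightarrow> (\<lambda>i. a * u i + b * v i) \<in> lat n"
  by (simp add: lat_def)

lemma subgroup_Aut_lat:
  "subgroup {f \<in> Bij (lat n). lat_linear n f \<and> preserves_form n f} (BijGroup (lat n))"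
    (is "subgroup ?A ?G")
proof -
  interpret G: group ?G by (rule group_BijGroup)
  have mem: "f u \<in> lat n" if "f \<in> Bij (lat n)" "u \<in> lat n" for f u
    using that Bij_imp_funcset by blast
  show ?thesis
  proof (rule G.subgroupI)
    show "?A \<subseteq> carrier ?G" by (auto simp: BijGroup_def)
    have "(\<lambda>x\<in>lat n. x) \<in> ?A"
      by (simp add: id_Bij lat_linear_def preserves_form_def lat_lin_comb)
    thus "?A \<noteq> {}" by blast
  next
    fix f assume f: "f \<in> ?A"
    let ?g = "\<lambda>x\<in>lat n. inv_into (lat n) f x"
    have gB: "?g \<in> Bij (lat n)" using f restrict_inv_into_Bij by blast
    have bij: "bij_betw f (lat n) (lat n)" using f by (simp add: Bij_def)
    have inv: "inv\<^bsub>?G\<^esub> f = ?g" using f by (simp add: inv_BijGroup)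
    have fg: "f (?g u) = u" if "u \<in> lat n" for u
      using that bij by (simp add: bij_betw_inv_into_right)
    have gm: "?g u \<in> lat n" if "u \<in> lat n" for u using gB that mem by blast
    have gf: "?g (f w) = w" if "w \<in> lat n" for w
      using that bij f mem by (simp add: bij_betw_inv_into_left)
    have "lat_linear n ?g" unfolding lat_linear_def
    proof (intro allI ballI)
      fix a b u v assume uv: "u \<in> lat n" "v \<in> lat n"
      have "f (\<lambda>i. a * ?g u i + b * ?g v i) = (\<lambda>i. a * f (?g u) i + b * f (?g v) i)"
        using f gm[OF uv(1)] gm[OF uv(2)] unfolding lat_linear_def by blast
      also have "\<dots> = (\<lambda>i. a * u i + b * v i)" using fg uv by metis
      finally show "?g (\<lambda>i. a * u i + b * v i) = (\<lambda>i. a * ?g u i + b * ?g v i)"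
        using gf[OF lat_lin_comb[OF gm[OF uv(1)] gm[OF uv(2)], of a b]] by metis
    qed
    moreover have "preserves_form n ?g"
      using f gm fg unfolding preserves_form_def mem_Collect_eq by metis
    ultimately show "inv\<^bsub>?G\<^esub> f \<in> ?A" using gB inv by simp
  next
    fix f g assume fg: "f \<in> ?A" "g \<in> ?A"
    have "f \<otimes>\<^bsub>?G\<^esub> g = compose (lat n) f g" using fg by (simp add: BijGroup_def)
    moreover have "compose (lat n) f g \<in> ?A"
      using fg mem by (simp add: compose_Bij lat_linear_def preserves_form_def compose_eq lat_lin_comb)
    ultimately show "f \<otimes>\<^bsub>?G\<^esub> g \<in> ?A" by simp
  qed
qed

lemma group_action_Aut_lat: "group_action (Aut_lat n) (lat n) (\<lambda>f. f)"
proof -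
  interpret G: group "BijGroup (lat n)" by (rule group_BijGroup)
  have "group (Aut_lat n)"
    unfolding Aut_lat_def by (rule G.subgroup_imp_group[OF subgroup_Aut_lat])
  moreover have "(\<lambda>f. f) \<in> hom (Aut_lat n) (BijGroup (lat n))"
    by (auto simp: hom_def Aut_lat_def BijGroup_def)
  ultimately show ?thesis
    by (simp add: group_action_def group_hom_def group_hom_axioms_def G.group_axioms)
qed

end

theory Submission
  imports Defs
begin

text \<open>
  The proof is a descent on \<open>\<bar>u\<^sup>0\<bar>\<close>. A characteristic vector has odd entries, so after sign changes all
  entries are positive. If \<open>u\<^sup>0 < u\<^sup>i + u\<^sup>j + u\<^sup>k\<close> for distinct \<open>i, j, k \<ge> 1\<close>, the reflection in the
  norm \<open>-2\<close> vector \<open>e\<^sub>0 + e\<^sub>i + e\<^sub>j + e\<^sub>k\<close> decreases \<open>\<bar>u\<^sup>0\<bar>\<close>. Otherwise let \<open>a \<ge> b \<ge> c\<close> be the three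
  largest of the entries \<open>u\<^sup>1, \<dots>, u\<^sup>n\<close>; then
  \<open>9 - n \<ge> (a + b + c)\<^sup>2 - a\<^sup>2 - b\<^sup>2 - c\<^sup>2 - (n - 3) c\<^sup>2 \<ge> (9 - n) c\<^sup>2\<close>, and equality throughout forces
  \<open>u\<close> to be a multiple of \<open>(3; 1, \<dots>, 1)\<close>. For \<open>n = 2\<close> the norm \<open>-1\<close> vector \<open>e\<^sub>0 + e\<^sub>1 + e\<^sub>2\<close> plays the
  same role.
\<close>

section \<open>The form and its automorphisms\<close>

lemma form_commute: "form n u v = form n v u"
  by (simp add: form_def mult.commute)

lemma form_lin_left:
  "form n (\<lambda>i. a * u i + b * v i) w = a * form n u w + b * form n v w"
  by (simp add: form_def algebra_simps sum.distrib sum_distrib_left)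

lemma form_lin_right:
  "form n w (\<lambda>i. a * u i + b * v i) = a * form n w u + b * form n w v"
  by (metis form_commute form_lin_left)

lemma Aut_lat_mem:
  assumes "g \<in> carrier (Aut_lat n)" "u \<in> lat n"
  shows "g u \<in> lat n"
  using assms by (auto simp: Aut_lat_def dest: Bij_imp_funcset)

lemma Aut_lat_form:
  assumes "g \<in> carrier (Aut_lat n)" "u \<in> lat n" "v \<in> lat n"
  shows "form n (g u) (g v) = form n u v"
  using assms by (auto simp: Aut_lat_def preserves_form_def)

lemma Aut_lat_scale:
  assumes "g \<in> carrier (Aut_lat n)" "u \<in> lat n"
  shows "g (\<lambda>i. k * u i) = (\<lambda>i. k * g u i)"
proof -
  have "lat_linear n g" using assms(1) by (simp add: Aut_lat_def)
  then have "g (\<lambda>i. k * u i + 0 * u i) = (\<lambda>i. k * g u i + 0 * g u i)"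
    using assms(2) unfolding lat_linear_def by blast
  then show ?thesis by simp
qed

lemma Aut_lat_inverse:
  assumes "g \<in> carrier (Aut_lat n)"
  obtains h where "h \<in> carrier (Aut_lat n)"
    "\<And>u. u \<in> lat n \<Longrightarrow> h (g u) = u" "\<And>u. u \<in> lat n \<Longrightarrow> g (h u) = u"
proof -
  interpret A: group_action "Aut_lat n" "lat n" "\<lambda>f. f"
    by (rule group_action_Aut_lat)
  interpret group "Aut_lat n"
    using A.group_hom group_hom.axioms(1) by blast
  let ?h = "inv\<^bsub>Aut_lat n\<^esub> g"
  have h: "?h \<in> carrier (Aut_lat n)" using assms by simp
  have hg: "?h (g u) = u" if "u \<in> lat n" for u
    using A.orbit_sym_aux[OF assms that refl] .
  have "g (?h u) = u" if "u \<in> lat n" for u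
    using A.orbit_sym_aux[OF h that refl] assms by simp
  with h hg that show ?thesis by blast
qed

text \<open>Both properties travel through the inverse \<open>h\<close>: a factor \<open>k\<close>
  of \<open>g u\<close> is also a factor of \<open>u\<close>, and testing \<open>g u\<close> against
  \<open>x\<close> amounts to testing \<open>u\<close> against \<open>h x\<close>.\<close>

lemma Aut_lat_prim_char:
  assumes g: "g \<in> carrier (Aut_lat n)" and u: "u \<in> prim_char_vectors n m"
  shows "g u \<in> prim_char_vectors n m"
proof -
  obtain h where h: "h \<in> carrier (Aut_lat n)"
    and hg: "\<And>u. u \<in> lat n \<Longrightarrow> h (g u) = u" and gh: "\<And>u. u \<in> lat n \<Longrightarrow> g (h u) = u"
    using Aut_lat_inverse[OF g] by blast
  have ul: "u \<in> lat n" and prim: "primitive n u" and char: "characteristic n u"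
    and norm: "form n u u = m"
    using u by (auto simp: prim_char_vectors_def)
  have "primitive n (g u)"
    unfolding primitive_def
  proof
    assume "\<exists>k>1. g u \<in> (\<lambda>v i. k * v i) ` lat n"
    then obtain k v where k: "k > 1" "v \<in> lat n" "g u = (\<lambda>i. k * v i)" by blast
    then have "u = (\<lambda>i. k * h v i)"
      using hg[OF ul] Aut_lat_scale[OF h] by metis
    then have "u \<in> (\<lambda>v i. k * v i) ` lat n" using Aut_lat_mem[OF h k(2)] by blast
    with k(1) prim show False unfolding primitive_def by blast
  qed
  moreover have "characteristic n (g u)"
    unfolding characteristic_def
  proof
    fix x assume x: "x \<in> lat n"
    note hx = Aut_lat_mem[OF h x]
    have "form n (g u) x = form n u (h x)" "form n x x = form n (h x) (h x)"
      using Aut_lat_form[OF g ul hx] Aut_lat_form[OF g hx hx] gh[OF x] by simp_all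
    with char hx show "[form n (g u) x = form n x x] (mod 2)"
      unfolding characteristic_def by simp
  qed
  moreover have "form n (g u) (g u) = m" using Aut_lat_form[OF g ul ul] norm by simp
  ultimately show ?thesis
    using Aut_lat_mem[OF g ul] by (simp add: prim_char_vectors_def)
qed

text \<open>Sign changes and reflections are involutions, so bijectivity comes for free. The
  \<open>restrict\<close> is there because members of \<open>Bij\<close> are extensional.\<close>

lemma involution_in_Aut_lat:
  assumes mem: "\<And>u. u \<in> lat n \<Longrightarrow> f u \<in> lat n"
    and inv: "\<And>u. u \<in> lat n \<Longrightarrow> f (f u) = u"
    and lin: "lat_linear n f" and pres: "preserves_form n f"
  shows "restrict f (lat n) \<in> carrier (Aut_lat n)"
proof -
  have "bij_betw f (lat n) (lat n)"
    using mem inv by (intro bij_betw_byWitness[where f' = f]) auto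
  then have "restrict f (lat n) \<in> Bij (lat n)" by (simp add: Bij_def)
  then show ?thesis
    using lin pres by (simp add: Aut_lat_def lat_linear_def preserves_form_def lat_lin_comb)
qed

lemma restrict_in_orbit:
  assumes "restrict f (lat n) \<in> carrier (Aut_lat n)" "u \<in> lat n"
  shows "f u \<in> orbit (Aut_lat n) (\<lambda>f. f) u"
proof -
  have "f u = restrict f (lat n) u" using assms(2) by simp
  with assms(1) show ?thesis unfolding orbit_def by blast
qed

lemma orbit_Aut_lat_trans:
  assumes "v \<in> orbit (Aut_lat n) (\<lambda>f. f) u" "w \<in> orbit (Aut_lat n) (\<lambda>f. f) v" "u \<in> lat n"
  shows "w \<in> orbit (Aut_lat n) (\<lambda>f. f) u"
proof -
  interpret A: group_action "Aut_lat n" "lat n" "\<lambda>f. f"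
    by (rule group_action_Aut_lat)
  have "v \<in> lat n" "w \<in> lat n" using assms Aut_lat_mem by (auto simp: orbit_def)
  then show ?thesis using A.orbit_trans assms by blast
qed

section \<open>Sign changes and reflections\<close>

definition sign_change :: "(nat \<Rightarrow> int) \<Rightarrow> (nat \<Rightarrow> int) \<Rightarrow> nat \<Rightarrow> int" where
  "sign_change s u = (\<lambda>i. s i * u i)"

lemma sign_change_in_Aut_lat:
  assumes "\<And>i. s i * s i = 1"
  shows "restrict (sign_change s) (lat n) \<in> carrier (Aut_lat n)"
proof (rule involution_in_Aut_lat)
  have *: "s i * a * (s i * b) = a * b" for i a b
    using assms[of i] by (metis mult.assoc mult.left_commute mult_1)
  show "preserves_form n (sign_change s)"
    by (simp add: preserves_form_def sign_change_def form_def *)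
  show "sign_change s (sign_change s u) = u" for u
    using assms by (simp add: sign_change_def flip: mult.assoc)
qed (auto simp: sign_change_def lat_def lat_linear_def algebra_simps)

text \<open>With \<open>c = -2 / r\<^sup>2\<close> this is the reflection in \<open>r\<close>.\<close>

definition reflection :: "nat \<Rightarrow> int \<Rightarrow> (nat \<Rightarrow> int) \<Rightarrow> (nat \<Rightarrow> int) \<Rightarrow> nat \<Rightarrow> int" where
  "reflection n c r u = (\<lambda>i. 1 * u i + (c * form n u r) * r i)"

lemma reflection_in_Aut_lat:
  assumes r: "r \<in> lat n" and c: "c * form n r r = -2"
  shows "restrict (reflection n c r) (lat n) \<in> carrier (Aut_lat n)"
proof (rule involution_in_Aut_lat)
  show "reflection n c r u \<in> lat n" if "u \<in> lat n" for u
    using that r unfolding reflection_def by (rule lat_lin_comb)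
  show "reflection n c r (reflection n c r u) = u" for u
  proof
    fix i
    have "form n (reflection n c r u) r = form n u r + c * form n r r * form n u r"
      by (simp only: reflection_def form_lin_left) (simp add: algebra_simps)
    also have "\<dots> = - form n u r" using c by simp
    finally show "reflection n c r (reflection n c r u) i = u i"
      by (simp add: reflection_def)
  qed
  show "lat_linear n (reflection n c r)"
    unfolding lat_linear_def reflection_def form_lin_left by (simp add: algebra_simps)
  show "preserves_form n (reflection n c r)"
    unfolding preserves_form_def
  proof (intro ballI)
    fix u v
    \<comment> \<open>The two cross terms and the quadratic term collect into a multiple of
      \<open>2 + c * form n r r\<close>, which vanishes.\<close>
    have "form n (reflection n c r u) (reflection n c r v)
      = form n u v + c * form n u r * form n v r * (2 + c * form n r r)"
      by (simp only: reflection_def form_lin_left form_lin_right form_commute[of n r v])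
        (simp add: algebra_simps)
    then show "form n (reflection n c r u) (reflection n c r v) = form n u v"
      using c by simp
  qed
qed

definition root :: "nat set \<Rightarrow> nat \<Rightarrow> int" where
  "root S = (\<lambda>i. if i \<in> insert 0 S then 1 else 0)"

lemma form_root:
  assumes "S \<subseteq> {1..n}"
  shows "form n u (root S) = u 0 - (\<Sum>i\<in>S. u i)"
proof -
  have "(\<Sum>i=1..n. u i * root S i) = (\<Sum>i=1..n. if i \<in> S then u i else 0)"
    by (intro sum.cong) (auto simp: root_def)
  also have "\<dots> = (\<Sum>i\<in>S. u i)"
    using assms by (simp add: Int_absorb1 flip: sum.inter_restrict)
  finally show ?thesis by (simp add: form_def root_def)
qed

text \<open>\<open>root S\<close> has norm \<open>1 - card S\<close>, so the condition makes
  \<open>c\<close> the integer -2 / r^2: \<open>c = 1\<close> for three indices,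
  \<open>c = 2\<close> for two.\<close>

lemma reflection_root_in_Aut_lat:
  assumes S: "S \<subseteq> {1..n}" and c: "c * (int (card S) - 1) = 2"
  shows "restrict (reflection n c (root S)) (lat n) \<in> carrier (Aut_lat n)"
proof (rule reflection_in_Aut_lat)
  show "root S \<in> lat n" using S by (auto simp: root_def lat_def)
  have "(\<Sum>i\<in>S. root S i) = int (card S)" by (simp add: root_def)
  then have "form n (root S) (root S) = 1 - int (card S)"
    using form_root[OF S, of "root S"] by (simp add: root_def)
  then have "c * form n (root S) (root S) = - (c * (int (card S) - 1))"
    by (simp only: minus_diff_eq flip: mult_minus_right)
  with c show "c * form n (root S) (root S) = -2" by simp
qed

section \<open>The descent\<close>

text \<open>Up to the signs of the e_i, this is the anticanonical class 3H - E_1 - ... - E_n of the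
  plane blown up in n points.\<close>

definition weyl_vec :: "nat \<Rightarrow> nat \<Rightarrow> int" where
  "weyl_vec n = (\<lambda>i. if i = 0 then 3 else if i \<le> n then 1 else 0)"

text \<open>Pairing with the basis vector e_i gives \<open>u i\<close> up to sign, and e_i has norm
  1 or -1.\<close>

lemma characteristic_odd:
  assumes "characteristic n u" "i \<le> n"
  shows "odd (u i)"
proof -
  define x :: "nat \<Rightarrow> int" where "x = (\<lambda>j. if j = i then 1 else 0)"
  have x: "x \<in> lat n" and x_i: "x i = 1" using assms by (simp_all add: x_def lat_def)
  have "(\<Sum>j=1..n. v j * x j) = (if i \<in> {1..n} then v i else 0)" for v
    by (simp add: x_def if_distrib cong: if_cong)
  then have *: "form n v x = (if i = 0 then v 0 else - v i)" for v
    using assms(2) by (simp add: form_def) (simp add: x_def)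
  have "[form n u x = form n x x] (mod 2)"
    using assms(1) x by (simp add: characteristic_def)
  then have "[if i = 0 then u 0 else - u i = (if i = 0 then 1 else -1)] (mod 2)"
    unfolding * using x_i by (cases "i = 0") auto
  then have "even ((if i = 0 then u 0 else - u i) - (if i = 0 then 1 else -1))"
    by (simp only: cong_iff_dvd_diff)
  then show ?thesis by (auto split: if_splits)
qed

lemma weyl_vec_prim_char:
  assumes "1 \<le> n"
  shows "weyl_vec n \<in> prim_char_vectors n (9 - int n)"
proof -
  have sum: "(\<Sum>i=1..n. weyl_vec n i * x i) = (\<Sum>i=1..n. x i)" for x
    by (intro sum.cong) (auto simp: weyl_vec_def)
  have form: "form n (weyl_vec n) x = 3 * x 0 - (\<Sum>i=1..n. x i)" for x
    unfolding form_def sum by (simp add: weyl_vec_def)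
  have "(\<Sum>i=1..n. weyl_vec n i) = int n"
    by (simp add: weyl_vec_def)
  then have norm: "form n (weyl_vec n) (weyl_vec n) = 9 - int n"
    unfolding form by (simp add: weyl_vec_def)
  have "characteristic n (weyl_vec n)"
    unfolding characteristic_def
  proof
    fix x
    \<comment> \<open>The difference splits into terms t - t^2 or t^2 - t and an even multiple of
      \<open>x 0\<close>.\<close>
    have "form n (weyl_vec n) x - form n x x
      = (x 0 - x 0 * x 0) + 2 * x 0 + (\<Sum>i=1..n. x i * x i - x i)"
      unfolding form by (simp add: form_def sum_subtractf)
    moreover have "even (\<Sum>i=1..n. x i * x i - x i)" by (intro dvd_sum) simp
    ultimately show "[form n (weyl_vec n) x = form n x x] (mod 2)"
      by (simp add: cong_iff_dvd_diff)
  qed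
  moreover have "primitive n (weyl_vec n)"
    unfolding primitive_def
  proof
    assume "\<exists>k>1. weyl_vec n \<in> (\<lambda>v i. k * v i) ` lat n"
    then obtain k v where k: "k > 1" "weyl_vec n = (\<lambda>i. k * v i)" by blast
    \<comment> \<open>Coordinate 1 exists because \<open>1 \<le> n\<close>, and its entry 1 has no
      divisor \<open>k > 1\<close>.\<close>
    then have "k * v 1 = 1" using assms by (metis weyl_vec_def zero_neq_one)
    with k(1) show False by (simp add: zmult_eq_1_iff)
  qed
  ultimately show ?thesis
    using norm by (simp add: prim_char_vectors_def) (simp add: lat_def weyl_vec_def)
qed

section \<open>Reduced positive vectors\<close>

lemma three_largest:
  fixes f :: "nat \<Rightarrow> int"
  assumes "finite A" "3 \<le> card A"
  obtains i j k where "i \<in> A" "j \<in> A" "k \<in> A" "i \<noteq> j" "i \<noteq> k" "j \<noteq> k"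
    "f j \<le> f i" "f k \<le> f j" "\<And>l. l \<in> A - {i,j,k} \<Longrightarrow> f l \<le> f k"
proof -
  have max: "\<exists>i\<in>B. \<forall>l\<in>B. f l \<le> f i" if "B \<subseteq> A" "B \<noteq> {}" for B
  proof -
    have fin: "finite (f ` B)" using that assms finite_subset by blast
    have "Max (f ` B) \<in> f ` B" using that fin by simp
    then obtain i where "i \<in> B" "f i = Max (f ` B)" by (metis imageE)
    with fin show ?thesis by (metis Max_ge imageI)
  qed
  have ne: "A - F \<noteq> {}" if "finite F" "card F < 3" for F
    using that assms card_mono[of F A] by fastforce
  obtain i where i: "i \<in> A" "\<forall>l\<in>A. f l \<le> f i"
    using max[of A] ne[of "{}"] by auto
  obtain j where j: "j \<in> A - {i}" "\<forall>l\<in>A - {i}. f l \<le> f j"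
    using max[of "A - {i}"] ne[of "{i}"] by auto
  have "card {i, j} < 3" by (simp add: card_insert_if)
  then obtain k where k: "k \<in> A - {i,j}" "\<forall>l\<in>A - {i,j}. f l \<le> f k"
    using max[of "A - {i,j}"] ne[of "{i,j}"] by auto
  show ?thesis using i j k by (intro that[of i j k]) auto
qed

text \<open>Parity sharpens the bound: \<open>x\<close> is odd and \<open>a + b\<close> is even, so
  \<open>a + b + 1 \<le> x\<close>. Squaring leaves \<open>a * b + a + b \<le> 3\<close>, which only
  \<open>a = b = 1\<close> satisfies.\<close>

lemma reduced_eq_weyl_vec_2:
  fixes x a b :: int
  assumes "x\<^sup>2 - (a\<^sup>2 + b\<^sup>2) = 7" "a > 0" "b > 0" "odd x" "odd a" "odd b" "a + b \<le> x"
  shows "x = 3 \<and> a = 1 \<and> b = 1"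
proof -
  have "x \<noteq> a + b" using assms by auto
  then have "a + b + 1 \<le> x" using assms by simp
  then have "(a + b + 1)\<^sup>2 \<le> x\<^sup>2" using assms by (intro power_mono) auto
  then have ab: "a * b + a + b \<le> 3" using assms(1) by (simp add: power2_eq_square algebra_simps)
  moreover have "a * b \<ge> 1" using assms by (simp add: int_one_le_iff_zero_less)
  ultimately have 1: "a = 1" "b = 1" using assms by auto
  then have "x\<^sup>2 = 3\<^sup>2" using assms(1) by simp
  then have "x = 3 \<or> x = -3" by (simp only: power2_eq_iff)
  then have "x = 3" using assms by auto
  with 1 show ?thesis by simp
qed

lemma reduced_eq_weyl_vec:
  assumes n: "3 \<le> n" "n \<le> 9" and u: "u \<in> prim_char_vectors n (9 - int n)"
    and pos: "\<And>i. i \<le> n \<Longrightarrow> u i > 0"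
    and reduced: "\<And>S. S \<subseteq> {1..n} \<Longrightarrow> card S = 3 \<Longrightarrow> (\<Sum>i\<in>S. u i) \<le> u 0"
  shows "u = weyl_vec n"
proof -
  have ul: "u \<in> lat n" and prim: "primitive n u" and norm: "form n u u = 9 - int n"
    using u by (auto simp: prim_char_vectors_def)
  obtain i j k where ijk: "i \<in> {1..n}" "j \<in> {1..n}" "k \<in> {1..n}" "i \<noteq> j" "i \<noteq> k" "j \<noteq> k"
    and ord: "u j \<le> u i" "u k \<le> u j" "\<And>l. l \<in> {1..n} - {i,j,k} \<Longrightarrow> u l \<le> u k"
    using three_largest[of "{1..n}" u] n(1) by auto
  define T where "T = {1..n} - {i,j,k}"
  define a b c where "a = u i" and "b = u j" and "c = u k"
  have abc: "c \<le> b" "b \<le> a" "c \<ge> 1" using ord pos[of k] ijk by (auto simp: a_def b_def c_def)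
  have cardT: "int (card T) = int n - 3"
    using ijk n by (simp add: T_def card_Diff_subset)
  have split: "(\<Sum>l=1..n. (u l)\<^sup>2) = a\<^sup>2 + b\<^sup>2 + c\<^sup>2 + (\<Sum>l\<in>T. (u l)\<^sup>2)"
  proof -
    have "(\<Sum>l=1..n. (u l)\<^sup>2) = (\<Sum>l\<in>T. (u l)\<^sup>2) + (\<Sum>l\<in>{i,j,k}. (u l)\<^sup>2)"
      unfolding T_def by (rule sum.subset_diff) (use ijk in auto)
    then show ?thesis using ijk by (simp add: a_def b_def c_def)
  qed
  have "(\<Sum>l\<in>{i,j,k}. u l) \<le> u 0" using ijk by (intro reduced) auto
  then have u0: "a + b + c \<le> u 0" using ijk by (simp add: a_def b_def c_def)
  then have sq0: "(a + b + c)\<^sup>2 \<le> (u 0)\<^sup>2" using abc by (intro power_mono) auto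
  have sqT: "(u l)\<^sup>2 \<le> c\<^sup>2" if "l \<in> T" for l
    using that ord pos[of l] by (intro power_mono) (auto simp: T_def c_def)
  have sumT: "(\<Sum>l\<in>T. (u l)\<^sup>2) \<le> (int n - 3) * c\<^sup>2"
    using sum_bounded_above[of T "\<lambda>l. (u l)\<^sup>2" "c\<^sup>2"] sqT cardT by simp
  have norm': "(u 0)\<^sup>2 - (a\<^sup>2 + b\<^sup>2 + c\<^sup>2 + (\<Sum>l\<in>T. (u l)\<^sup>2)) = 9 - int n"
    using norm split by (simp add: form_def power2_eq_square)
  \<comment> \<open>\<open>E\<close> is (a + b + c)^2 - a^2 - b^2 - c^2 - 6 c^2; it is non-negative
    since each of ab, ac, bc is at least c^2.\<close>
  define E where "E = 2 * (a * b + a * c + b * c) - 6 * c\<^sup>2"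
  have ac: "c\<^sup>2 \<le> a * c" "c\<^sup>2 \<le> b * c" "b * c \<le> a * b"
    using abc mult_right_mono[of c a c] mult_right_mono[of c b c] mult_mono[of c a b b]
    by (auto simp: power2_eq_square mult.commute)
  have E0: "E \<ge> 0" using ac by (simp add: E_def)
  \<comment> \<open>The norm equation rearranged: three non-negative terms on the left, and a right
    side that is at most 0 because \<open>n \<le> 9\<close> and \<open>c \<ge> 1\<close>. All three
    must vanish.\<close>
  have total: "((u 0)\<^sup>2 - (a + b + c)\<^sup>2) + E + ((int n - 3) * c\<^sup>2 - (\<Sum>l\<in>T. (u l)\<^sup>2))
      = (9 - int n) * (1 - c\<^sup>2)"
    using norm' by (simp add: E_def power2_eq_square algebra_simps)
  have c1: "1 \<le> c\<^sup>2" using abc by simp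
  have "(9 - int n) * (1 - c\<^sup>2) \<le> 0" using n c1 by (intro mult_nonneg_nonpos) auto
  with total E0 sq0 sumT have eqs: "E = 0" "(u 0)\<^sup>2 = (a + b + c)\<^sup>2"
    "(\<Sum>l\<in>T. (u l)\<^sup>2) = (int n - 3) * c\<^sup>2" by linarith+
  \<comment> \<open>Three products, each at least c^2, add up to 3 c^2, so each equals c^2.\<close>
  have "a * b + a * c + b * c = 3 * c\<^sup>2" using eqs(1) by (simp add: E_def)
  then have "a * c = c\<^sup>2" "b * c = c\<^sup>2" using ac by linarith+
  then have ab: "a = c" "b = c" using abc by (auto simp: power2_eq_square)
  have "u 0 = a + b + c"
    using eqs(2) by (rule power2_eq_imp_eq) (use u0 abc in auto)
  then have x: "u 0 = 3 * c" using ab by simp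
  have "(\<Sum>l\<in>T. c\<^sup>2 - (u l)\<^sup>2) = 0" using eqs(3) cardT by (simp add: sum_subtractf)
  moreover have "finite T" by (simp add: T_def)
  ultimately have eqT: "\<forall>l\<in>T. c\<^sup>2 - (u l)\<^sup>2 = 0"
    using sqT by (subst (asm) sum_nonneg_eq_0_iff) auto
  have T: "u l = c" if "l \<in> T" for l
  proof (rule power2_eq_imp_eq)
    show "(u l)\<^sup>2 = c\<^sup>2" using bspec[OF eqT that] by simp
    show "0 \<le> u l" using that pos[of l] by (simp add: T_def)
    show "0 \<le> c" using abc by simp
  qed
  have all: "u l = c" if "l \<in> {1..n}" for l
    using that T[of l] ab by (cases "l \<in> T") (auto simp: T_def a_def b_def c_def)
  have "u = (\<lambda>l. c * weyl_vec n l)"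
  proof
    fix l
    show "u l = c * weyl_vec n l"
      using x all[of l] ul by (auto simp: weyl_vec_def lat_def)
  qed
  moreover have "weyl_vec n \<in> lat n" by (simp add: lat_def weyl_vec_def)
  \<comment> \<open>For \<open>n = 9\<close> the norm is 0 for every \<open>c\<close>, so only
    primitivity can fix the scale.\<close>
  ultimately have "\<not> c > 1" using prim unfolding primitive_def by blast
  with abc have "c = 1" by simp
  with \<open>u = (\<lambda>l. c * weyl_vec n l)\<close> show ?thesis by simp
qed

section \<open>Decrease of the zeroth coordinate\<close>

text \<open>The new value 3x - 2(a + b) is below x by assumption; it exceeds -x iff a + b < 2x,
  which follows from (a + b)^2 \<le> 2(a^2 + b^2).\<close>

lemma reflection_decreases_2:
  fixes x a b :: int
  assumes "x > 0" "a\<^sup>2 + b\<^sup>2 \<le> x\<^sup>2" "x < a + b"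
  shows "\<bar>x + 2 * (x - (a + b))\<bar> < x"
proof -
  have "(a + b)\<^sup>2 \<le> 2 * (a\<^sup>2 + b\<^sup>2)"
    using zero_le_power2[of "a - b"] by (simp add: power2_eq_square algebra_simps)
  also have "\<dots> \<le> 2 * x\<^sup>2" using assms(2) by simp
  also have "\<dots> < 4 * x\<^sup>2" using assms(1) by simp
  also have "\<dots> = (2 * x)\<^sup>2" by (simp add: power_mult_distrib)
  finally have "a + b < 2 * x" by (rule power_less_imp_less_base) (use assms in simp)
  then show ?thesis using assms(3) by (simp add: abs_less_iff)
qed

text \<open>Here the lower bound amounts to a + b + c < 3x, obtained from Cauchy-Schwarz with the
  factor 3.\<close>

lemma reflection_decreases_3:
  fixes x a b c :: int
  assumes "x > 0" "a\<^sup>2 + b\<^sup>2 + c\<^sup>2 \<le> x\<^sup>2" "x < a + b + c"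
  shows "\<bar>x + (x - (a + b + c))\<bar> < x"
proof -
  have "(a + b + c)\<^sup>2 \<le> 3 * (a\<^sup>2 + b\<^sup>2 + c\<^sup>2)"
    using zero_le_power2[of "a - b"] zero_le_power2[of "a - c"] zero_le_power2[of "b - c"]
    by (simp add: power2_eq_square algebra_simps)
  also have "\<dots> \<le> 3 * x\<^sup>2" using assms(2) by simp
  also have "\<dots> < 9 * x\<^sup>2" using assms(1) by simp
  also have "\<dots> = (3 * x)\<^sup>2" by (simp add: power_mult_distrib)
  finally have "a + b + c < 3 * x" by (rule power_less_imp_less_base) (use assms in simp)
  then show ?thesis using assms(3) by (simp add: abs_less_iff)
qed

lemma positive_reduction_step:
  assumes n: "2 \<le> n" "n \<le> 9" and u: "u \<in> prim_char_vectors n (9 - int n)"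
    and pos: "\<And>i. i \<le> n \<Longrightarrow> u i > 0" and neq: "u \<noteq> weyl_vec n"
  obtains v where "v \<in> orbit (Aut_lat n) (\<lambda>f. f) u" "\<bar>v 0\<bar> < \<bar>u 0\<bar>"
proof -
  note result = that
  have ul: "u \<in> lat n" and char: "characteristic n u" and norm: "form n u u = 9 - int n"
    using u by (auto simp: prim_char_vectors_def)
  have norm': "(u 0)\<^sup>2 - (\<Sum>i=1..n. (u i)\<^sup>2) = 9 - int n"
    using norm by (simp add: form_def power2_eq_square)
  \<comment> \<open>The norm \<open>9 - n\<close> is non-negative, so \<open>(u 0)^2\<close> bounds
    the sum of squares over any set of other coordinates.\<close>
  have sub: "(\<Sum>i\<in>S. (u i)\<^sup>2) \<le> (u 0)\<^sup>2" if "S \<subseteq> {1..n}" for S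
    using sum_mono2[OF _ that, of "\<lambda>i. (u i)\<^sup>2"] norm' n by simp
  have refl: thesis if S: "S \<subseteq> {1..n}" and c: "c * (int (card S) - 1) = 2"
    and less: "\<bar>u 0 + c * (u 0 - (\<Sum>i\<in>S. u i))\<bar> < u 0" for S c
  proof (rule result)
    show "reflection n c (root S) u \<in> orbit (Aut_lat n) (\<lambda>f. f) u"
      by (rule restrict_in_orbit[OF reflection_root_in_Aut_lat[OF S c] ul])
    have "reflection n c (root S) u 0 = u 0 + c * (u 0 - (\<Sum>i\<in>S. u i))"
      unfolding reflection_def form_root[OF S] by (simp add: root_def)
    with less show "\<bar>reflection n c (root S) u 0\<bar> < \<bar>u 0\<bar>" by linarith
  qed
  show thesis
  proof (cases "n = 2")
    case True
    have *: "{1..n} = {1, 2}" using True by auto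
    have norm2: "(u 0)\<^sup>2 - ((u 1)\<^sup>2 + (u 2)\<^sup>2) = 7"
      using norm' unfolding * by (simp add: True)
    have "u 0 < u 1 + u 2"
    proof (rule ccontr)
      assume "\<not> ?thesis"
      then have "u 0 = 3 \<and> u 1 = 1 \<and> u 2 = 1"
        using norm2 pos characteristic_odd[OF char] True
        by (intro reduced_eq_weyl_vec_2) auto
      then have "u i = weyl_vec n i" for i
        using ul True * by (cases "i \<in> {1,2}") (auto simp: weyl_vec_def lat_def)
      with neq show False by blast
    qed
    then have "\<bar>u 0 + 2 * (u 0 - (u 1 + u 2))\<bar> < u 0"
      using norm2 pos[of 0] by (intro reflection_decreases_2) auto
    then show thesis by (intro refl[of "{1,2}" 2]) (auto simp: True)
  next
    case False
    with n have "3 \<le> n" by simp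
    \<comment> \<open>Contrapositive of the classification: a positive vector other than
      \<open>weyl_vec n\<close> violates one of the three-index inequalities.\<close>
    then obtain S where S: "S \<subseteq> {1..n}" "card S = 3" "u 0 < (\<Sum>i\<in>S. u i)"
      using reduced_eq_weyl_vec[OF _ n(2) u pos] neq by (meson not_le)
    obtain i j k where ijk: "S = {i,j,k}" "i \<noteq> j" "i \<noteq> k" "j \<noteq> k"
      using S(2) by (auto simp: card_3_iff)
    have sum: "(\<Sum>l\<in>S. f l) = f i + f j + f k" for f :: "nat \<Rightarrow> int"
      using ijk by (simp add: add.assoc)
    have "\<bar>u 0 + (u 0 - (u i + u j + u k))\<bar> < u 0"
      using S(3) sub[OF S(1)] pos[of 0] unfolding sum by (intro reflection_decreases_3) auto
    then have "\<bar>u 0 + 1 * (u 0 - (\<Sum>l\<in>S. u l))\<bar> < u 0" by (simp add: sum)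
    then show thesis by (rule refl[OF S(1), rotated]) (simp add: S(2))
  qed
qed

text \<open>Sign changes keep \<open>\<bar>u 0\<bar>\<close>, so each round can first restore
  positivity, which a reflection may destroy, and then reflect.\<close>

lemma weyl_vec_in_orbit:
  assumes n: "2 \<le> n" "n \<le> 9" and "u \<in> prim_char_vectors n (9 - int n)"
  shows "weyl_vec n \<in> orbit (Aut_lat n) (\<lambda>f. f) u"
  using assms(3)
proof (induction "nat \<bar>u 0\<bar>" arbitrary: u rule: less_induct)
  case less
  have ul: "u \<in> lat n" and char: "characteristic n u"
    using less.prems by (auto simp: prim_char_vectors_def)
  \<comment> \<open>Zero entries, as beyond index \<open>n\<close>, get sign 1, so that
    \<open>s i * s i = 1\<close> holds at every index.\<close>
  define s :: "nat \<Rightarrow> int" where "s i = (if u i < 0 then -1 else 1)" for i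
  define v where "v = sign_change s u"
  let ?g = "restrict (sign_change s) (lat n)"
  have g: "?g \<in> carrier (Aut_lat n)"
    by (rule sign_change_in_Aut_lat) (simp add: s_def)
  have gu: "?g u = v" using ul by (simp add: v_def)
  have vo: "v \<in> orbit (Aut_lat n) (\<lambda>f. f) u" unfolding v_def by (rule restrict_in_orbit[OF g ul])
  have v: "v \<in> prim_char_vectors n (9 - int n)"
    using Aut_lat_prim_char[OF g less.prems] gu by simp
  have abs: "v i = \<bar>u i\<bar>" for i by (simp add: v_def sign_change_def s_def)
  have pos: "v i > 0" if "i \<le> n" for i
    using characteristic_odd[OF char that] abs by auto
  show ?case
  proof (cases "v = weyl_vec n")
    case True
    with vo show ?thesis by simp
  next
    case False
    then obtain w where w: "w \<in> orbit (Aut_lat n) (\<lambda>f. f) v" "\<bar>w 0\<bar> < \<bar>v 0\<bar>"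
      using positive_reduction_step[OF n v pos] by blast
    have "w \<in> prim_char_vectors n (9 - int n)"
      using w(1) Aut_lat_prim_char[OF _ v] by (auto simp: orbit_def)
    then have "weyl_vec n \<in> orbit (Aut_lat n) (\<lambda>f. f) w"
      using less.hyps[of w] w(2) abs[of 0] by simp
    moreover have "w \<in> orbit (Aut_lat n) (\<lambda>f. f) u"
      using orbit_Aut_lat_trans[OF vo w(1) ul] .
    ultimately show ?thesis using orbit_Aut_lat_trans ul by blast
  qed
qed

theorem theorem1:
  fixes n :: nat
  assumes "2 \<le> n" and "n \<le> 9"
  shows "prim_char_vectors n (9 - int n) \<noteq> {} \<and>
    prim_char_vectors n (9 - int n) \<in> orbits (Aut_lat n) (lat n) (\<lambda>f. f)"
proof -
  interpret A: group_action "Aut_lat n" "lat n" "\<lambda>f. f"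
    by (rule group_action_Aut_lat)
  let ?P = "prim_char_vectors n (9 - int n)"
  let ?w = "weyl_vec n"
  have w: "?w \<in> ?P" using assms by (intro weyl_vec_prim_char) simp
  have P: "?P \<subseteq> lat n" by (auto simp: prim_char_vectors_def)
  have "?P = orbit (Aut_lat n) (\<lambda>f. f) ?w"
  proof
    \<comment> \<open>The descent runs from \<open>u\<close> to \<open>?w\<close>; symmetry of
      orbits reverses it.\<close>
    show "?P \<subseteq> orbit (Aut_lat n) (\<lambda>f. f) ?w"
      using weyl_vec_in_orbit[OF assms] A.orbit_sym P w by blast
    show "orbit (Aut_lat n) (\<lambda>f. f) ?w \<subseteq> ?P"
      using Aut_lat_prim_char w by (auto simp: orbit_def)
  qed
  with w P show ?thesis by (auto simp: orbits_def)
qed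

end
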